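(* Let $\mathbf Z=(\mathbf Y,\mathbf X)$ be an ergodic unreliable Jackson network process with routing matrix $R$, and let $\mathbf Z'=(\mathbf Y',\mathbf X')$ be another unreliable Jackson network process having the same arrival and service intensities and the same routing regime, described by the same $R$ and the same rerouting matrices $(R^D)_{D\subseteq\tilde J}$ satisfying the rerouting assumption. The breakdown-repair process $\mathbf Y$ of $\mathbf Z$ is defined by functions $A,B$, and that of $\mathbf Z'$, $\mathbf Y'$, is defined in the same way by functions $A',B':2^{\tilde J}\to[0,\infty)$ subject to the same restrictions, so that $q^{\mathbf Y'}(D,I)=A'(I)/A'(D)$ for $D\subset I\subseteq\tilde J$ and $q^{\mathbf Y'}(D,H)=B'(D)/B'(H)$ for $H\subset D\subseteq\tilde J$. Assume that the stationary distributions of $\mathbf Y$ and $\mathbf Y'$ are identical: $$\hat\pi(D)=\hat C^{-1}\frac{A(D)}{B(D)}=\hat C'^{-1}\frac{A'(D)}{B'(D)},\qquad D\in2^{\tilde J}.$$ Then for arbitrary real functions $f,g\in L^2(\tilde{\mathbb E},\tilde\pi)$ $$\langle f,Q^{\mathbf Z}g\rangle_{\tilde\pi}-\langle f,Q^{\mathbf Z'}g\rangle_{\tilde\pi}=E_\pi\Big[\langle f(\circ,X_t),Q^{\mathbf Y}g(\cdot,X_t)(\circ)\rangle_{\hat\pi}-\langle f(\circ,X_t),Q^{\mathbf Y'}g(\cdot,X_t)(\circ)\rangle_{\hat\pi}\Big]$$ $$=E_\pi\Big[\langle f(\circ,X_t),(Q^{\mathbf Y}-Q^{\mathbf Y'}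)g(\cdot,X_t)(\circ)\rangle_{\hat\pi}\Big].$$
   Context: Notation: $\mathbb N=\{0,1,2,\dots\}$, $\tilde J=\{1,\dots,J\}$, $\tilde J_0=\{0,1,\dots,J\}$; $\subset$ denotes strict inclusion; $e_j$ is the $j$-th standard base vector of $\mathbb N^J$. $\langle f,g\rangle_{\nu}=\int fg\,d\nu$. $E_\pi$ is expectation when $X_t$ has distribution $\pi$, and for fixed $n$, $\langle f(\circ,n),Q g(\cdot,n)(\circ)\rangle_{\hat\pi}=\sum_{D\subseteq\tilde J}\hat\pi(D)f(D,n)\,(Qg(\cdot,n))(D)$. Network data: an arrival intensity $\lambda>0$; an irreducible stochastic routing matrix $R=[r_{ij}]_{i,j\in\tilde J_0}$ ($r_{00}\ge 0$ allowed; node $0$ is source and sink); service rates $\mu_j(k)>0$ for $k\ge1$, $\mu_j(0)=0$, with $\sup_{j,k}\mu_j(k)<\infty$. The traffic equations $\eta_j=\lambda r_{0j}+\sum_{i=1}^J\eta_ir_{ij}$, $j\in\tilde J$, have a unique solution $(\eta_j)_{j\in\tilde J}$. The network (without breakdowns) is assumed ergodic, i.e. $C_j:=\sum_{m\ge0}\prod_{k=1}^{m}\eta_j/\mu_j(k)<\infty$ for all $j$, and $\pi(n)=\prod_{j=1}^J C_j^{-1}\prod_{k=1}^{n_j}\frac{\eta_j}{\mu_j(k)}$ on $\mathbb N^J$. Breakdown and repair: functions $A,B:2^{\tilde J}\to[0,\infty)$ with $A(\emptyset)=B(\emptyset)=1$, $A(I)/A(D)<\infty$ for all $D\subset I\subseteq\tilde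 J$ and $B(D)/B(H)<\infty$ for all $H\subset D\subseteq\tilde J$ (conventions $0/0=0$, $1/0=\infty$). $\mathbf Y$ is the Markov process on $2^{\tilde J}$ (its state is the set of broken down nodes) with rates $q^{\mathbf Y}(D,I)=A(I)/A(D)$ for $D\subset I$, $q^{\mathbf Y}(D,H)=B(D)/B(H)$ for $H\subset D$, other off-diagonal rates zero, and generator $(Q^{\mathbf Y}h)(D)=\sum_{H\subset D}q^{\mathbf Y}(D,H)(h(H)-h(D))+\sum_{I\supset D}q^{\mathbf Y}(D,I)(h(I)-h(D))$. It is reversible with respect to the probability $\hat\pi(D)=\hat C^{-1}A(D)/B(D)$. Rerouting assumption: for each $D\subseteq\tilde J$ there is a stochastic matrix $R^D=[r^D_{ij}]_{i,j\in\tilde J_0\setminus D}$, $R^\emptyset=R$, such that $\eta_j=\lambda r^D_{0j}+\sum_{i\in\tilde J\setminus D}\eta_ir^D_{ij}$ for all $j\in\tilde J\setminus D$ (same $\eta$ for every $D$). Unreliable Jackson network process $\mathbf Z=(\mathbf Y,\mathbf X)$: the Markov process on $\tilde{\mathbb E}=2^{\tilde J}\times\mathbb N^J$ with generator $(Q^{\mathbf Z}f)(D,n)=\sum_{j\in\tilde J\setminus D}\lambda r^D_{0j}(f(D,n+e_j)-f(D,n))+\sum_{j\in\tilde J\setminus D}\mu_j(n_j)r^D_{j0}(f(D,n-e_j)-f(D,n))+\sum_{j\in\tilde J\setminus D}\mu_j(n_j)\sum_{i\in\tilde J\setminus D}r^D_{ji}(f(D,n-e_j+e_i)-f(D,n))+(Q^{\mathbf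 Y}f(\cdot,n))(D)$. Terms with factor $\mu_j(0)$ are zero. If $\mathbf Z$ is ergodic, its unique stationary distribution is known to be $\tilde\pi(D,n)=\hat\pi(D)\pi(n)$. $\mathbf Z'$ is built in the same way with $A',B'$ in place of $A,B$. *)

theory Defs
  imports "HOL-Probability.Probability"
begin

text \<open>
  The finite type \<open>'j\<close> is the node set \<open>{1, ..., J}\<close>. The extended set \<open>{0, 1, ..., J}\<close> is
  \<open>'j option\<close>, where \<open>None\<close> is node 0 (source and sink) and \<open>Some j\<close> is node \<open>j\<close>. A queue length
  vector is a function \<open>'j \<Rightarrow> nat\<close>, and a state of the unreliable network is a pair \<open>(D, n)\<close> of
  the set of broken down nodes and the queue length vector.
\<close>

definition stochastic_on :: "'i set \<Rightarrow> ('i \<Rightarrow> 'i \<Rightarrow> real) \<Rightarrow> bool" where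
  "stochastic_on S R \<longleftrightarrow> (\<forall>i\<in>S. (\<forall>j\<in>S. 0 \<le> R i j) \<and> (\<Sum>j\<in>S. R i j) = 1)"

definition irreducible_matrix :: "('i \<Rightarrow> 'i \<Rightarrow> real) \<Rightarrow> bool" where
  "irreducible_matrix R \<longleftrightarrow> (\<forall>i j. (i, j) \<in> {(a, b). 0 < R a b}\<^sup>*)"

locale jackson_network =
  fixes lam :: real
    and R :: "'j::finite option \<Rightarrow> 'j option \<Rightarrow> real"
    and mu :: "'j \<Rightarrow> nat \<Rightarrow> real"
    and eta :: "'j \<Rightarrow> real"
  assumes lam_pos: "0 < lam"
    and R_stochastic: "stochastic_on UNIV R"
    and R_irreducible: "irreducible_matrix R"
    and mu_zero: "mu j 0 = 0"
    and mu_pos: "1 \<le> k \<Longrightarrow> 0 < mu j k"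
    and mu_bounded: "bdd_above (range (\<lambda>(j, k). mu j k))"
    and traffic: "eta j = lam * R None (Some j) + (\<Sum>i\<in>UNIV. eta i * R (Some i) (Some j))"
    and network_ergodic: "summable (\<lambda>m. \<Prod>k=1..m. eta j / mu j k)"

definition network_dist :: "('j::finite \<Rightarrow> nat \<Rightarrow> real) \<Rightarrow> ('j \<Rightarrow> real) \<Rightarrow> ('j \<Rightarrow> nat) \<Rightarrow> real" where
  "network_dist mu eta n =
     (\<Prod>j\<in>UNIV. inverse (\<Sum>m. \<Prod>k=1..m. eta j / mu j k) * (\<Prod>k=1..n j. eta j / mu j k))"

text \<open>
  Of the rerouting matrix \<open>RD D\<close>, only the entries indexed by \<open>{0, 1, ..., J} \<setminus> D\<close>, that is by
  \<open>- Some ` D\<close>, are constrained (and used in the generator below).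
\<close>

locale rerouted_jackson_network = jackson_network lam R mu eta
  for lam :: real
    and R :: "'j::finite option \<Rightarrow> 'j option \<Rightarrow> real"
    and mu :: "'j \<Rightarrow> nat \<Rightarrow> real"
    and eta :: "'j \<Rightarrow> real" +
  fixes RD :: "'j set \<Rightarrow> 'j option \<Rightarrow> 'j option \<Rightarrow> real"
  assumes RD_empty: "RD {} = R"
    and RD_stochastic: "stochastic_on (- Some ` D) (RD D)"
    and RD_traffic: "j \<notin> D \<Longrightarrow>
      eta j = lam * RD D None (Some j) + (\<Sum>i\<in>-D. eta i * RD D (Some i) (Some j))"

text \<open>
  Quotients of breakdown and repair functions are restricted in \<^typ>\<open>ennreal\<close>, where
  \<open>0 / 0 = 0\<close> and \<open>x / 0 = \<infinity>\<close> for \<open>x > 0\<close>. For quotients restricted to be finite, division in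
  \<^typ>\<open>real\<close> agrees with this, so it is used for the rates.
\<close>

locale breakdown_repair =
  fixes A B :: "'j::finite set \<Rightarrow> real"
  assumes A_nonneg: "0 \<le> A D"
    and B_nonneg: "0 \<le> B D"
    and A_empty: "A {} = 1"
    and B_empty: "B {} = 1"
    and A_quotient: "D \<subset> I \<Longrightarrow> ennreal (A I) / ennreal (A D) < \<infinity>"
    and B_quotient: "H \<subset> D \<Longrightarrow> ennreal (B D) / ennreal (B H) < \<infinity>"

definition Y_rate :: "('j set \<Rightarrow> real) \<Rightarrow> ('j set \<Rightarrow> real) \<Rightarrow> 'j set \<Rightarrow> 'j set \<Rightarrow> real" where
  "Y_rate A B D E = (if D \<subset> E then A E / A D else if E \<subset> D then B D / B E else 0)"

definition Y_gen ::
  "('j::finite set \<Rightarrow> real) \<Rightarrow> ('j set \<Rightarrow> real) \<Rightarrow> ('j set \<Rightarrow> real) \<Rightarrow> 'j set \<Rightarrow> real" where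
  "Y_gen A B h D =
     (\<Sum>H | H \<subset> D. Y_rate A B D H * (h H - h D)) +
     (\<Sum>I | D \<subset> I. Y_rate A B D I * (h I - h D))"

text \<open>
  The normalised weights \<open>A D / B D\<close>. The quotients are again taken in \<^typ>\<open>ennreal\<close>, since
  finiteness of \<open>A D / B D\<close> is not among the restrictions on \<open>A\<close> and \<open>B\<close>; if some quotient is
  infinite, there is no probability of this form and the function is constantly 0.
\<close>

definition Y_dist :: "('j::finite set \<Rightarrow> real) \<Rightarrow> ('j set \<Rightarrow> real) \<Rightarrow> 'j set \<Rightarrow> real" where
  "Y_dist A B D =
     enn2real ((ennreal (A D) / ennreal (B D)) / (\<Sum>I\<in>UNIV. ennreal (A I) / ennreal (B I)))"

definition arrive :: "'j \<Rightarrow> ('j \<Rightarrow> nat) \<Rightarrow> 'j \<Rightarrow> nat" where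
  "arrive j n = n(j := n j + 1)"

text \<open>If \<open>n j = 0\<close>, truncated subtraction is harmless: departures then have rate \<open>mu j 0 = 0\<close>.\<close>

definition depart :: "'j \<Rightarrow> ('j \<Rightarrow> nat) \<Rightarrow> 'j \<Rightarrow> nat" where
  "depart j n = n(j := n j - 1)"

definition Z_gen ::
  "real \<Rightarrow> ('j::finite \<Rightarrow> nat \<Rightarrow> real) \<Rightarrow> ('j set \<Rightarrow> 'j option \<Rightarrow> 'j option \<Rightarrow> real) \<Rightarrow>
   ('j set \<Rightarrow> real) \<Rightarrow> ('j set \<Rightarrow> real) \<Rightarrow>
   ('j set \<times> ('j \<Rightarrow> nat) \<Rightarrow> real) \<Rightarrow> 'j set \<times> ('j \<Rightarrow> nat) \<Rightarrow> real" where
  "Z_gen lam mu RD A B f = (\<lambda>(D, n).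
     (\<Sum>j\<in>-D. lam * RD D None (Some j) * (f (D, arrive j n) - f (D, n))) +
     (\<Sum>j\<in>-D. mu j (n j) * RD D (Some j) None * (f (D, depart j n) - f (D, n))) +
     (\<Sum>j\<in>-D. mu j (n j) *
        (\<Sum>i\<in>-D. RD D (Some j) (Some i) * (f (D, arrive i (depart j n)) - f (D, n)))) +
     Y_gen A B (\<lambda>E. f (E, n)) D)"

definition Z_dist ::
  "('j::finite \<Rightarrow> nat \<Rightarrow> real) \<Rightarrow> ('j \<Rightarrow> real) \<Rightarrow> ('j set \<Rightarrow> real) \<Rightarrow> ('j set \<Rightarrow> real) \<Rightarrow>
   'j set \<times> ('j \<Rightarrow> nat) \<Rightarrow> real" where
  "Z_dist mu eta A B = (\<lambda>(D, n). Y_dist A B D * network_dist mu eta n)"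

text \<open>
  A conservative Markov transition function \<open>P\<close> on a countable state space with generator \<open>Q\<close>:
  semigroup property and Kolmogorov backward equation. For bounded rates, as in the case of the
  unreliable network, \<open>P\<close> is uniquely determined by \<open>Q\<close>.
\<close>

definition markov_semigroup ::
  "(('s \<Rightarrow> real) \<Rightarrow> 's \<Rightarrow> real) \<Rightarrow> (real \<Rightarrow> 's \<Rightarrow> 's pmf) \<Rightarrow> bool" where
  "markov_semigroup Q P \<longleftrightarrow>
     (\<forall>x. P 0 x = return_pmf x) \<and>
     (\<forall>s\<ge>0. \<forall>t\<ge>0. \<forall>x. P (s + t) x = bind_pmf (P s x) (P t)) \<and>
     (\<forall>t\<ge>0. \<forall>x y. ((\<lambda>t. pmf (P t x) y) has_real_derivative Q (\<lambda>z. pmf (P t z) y) x)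
        (at t within {0..}))"

text \<open>
  Ergodicity of the Markov process with generator \<open>Q\<close>: the transition probabilities converge to
  one and the same probability distribution from every initial state.
\<close>

definition ergodic_process :: "(('s \<Rightarrow> real) \<Rightarrow> 's \<Rightarrow> real) \<Rightarrow> bool" where
  "ergodic_process Q \<longleftrightarrow>
     (\<exists>P p. markov_semigroup Q P \<and> (\<forall>x y. ((\<lambda>t. pmf (P t x) y) \<longlongrightarrow> pmf p y) at_top))"

definition discrete_measure :: "('s \<Rightarrow> real) \<Rightarrow> 's measure" where
  "discrete_measure p = point_measure UNIV (\<lambda>x. ennreal (p x))"

definition L2_functions :: "'s measure \<Rightarrow> ('s \<Rightarrow> real) set" where
  "L2_functions M = {f \<in> borel_measurable M. integrable M (\<lambda>x. (f x)\<^sup>2)}"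

definition inner_on :: "'s measure \<Rightarrow> ('s \<Rightarrow> real) \<Rightarrow> ('s \<Rightarrow> real) \<Rightarrow> real" where
  "inner_on M f g = (\<integral>x. f x * g x \<partial>M)"

definition Y_inner :: "('j::finite set \<Rightarrow> real) \<Rightarrow> ('j set \<Rightarrow> real) \<Rightarrow> ('j set \<Rightarrow> real) \<Rightarrow> real" where
  "Y_inner p u v = (\<Sum>D\<in>UNIV. p D * u D * v D)"

end

theory Submission
  imports Defs
begin

text \<open>
  The generator of the unreliable network is the sum of \<open>X_gen\<close>, which moves customers while the
  set of broken down nodes is held fixed, and of \<open>Y_gen\<close>, which changes that set while the queue
  lengths are held fixed. The two networks share arrivals, services and rerouting, hence the
  summand \<open>X_gen\<close>, and they share the stationary distribution, so the difference of the two
  quadratic forms is the integral of \<open>f (D, n) * (QY - QY') (g (\<cdot>, n)) D\<close>. Since this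
  distribution is a product of the law of \<open>Y\<close> and the law \<open>network_dist mu eta\<close> of \<open>Xt\<close>,
  integrating over \<open>D\<close> first gives the expectation on the right hand side.

  What has to be proved is that every integral exists, since only then may the common summand be
  cancelled and the order of integration be chosen. Let \<open>w\<close> be the stationary weight of a state.
  Each generator is a finite sum of jumps \<open>x \<mapsto> \<sigma> x\<close> that happen at rate \<open>r x\<close>, where \<open>\<sigma>\<close> is
  injective on the states with \<open>r x \<noteq> 0\<close>. For such a jump
  \<open>w x * \<bar>f x * r x * g (\<sigma> x)\<bar> \<le> w x * \<bar>r x\<bar> * ((f x)\<^sup>2 + (g (\<sigma> x))\<^sup>2)\<close>.
  The first part is summable if the rates are bounded; the second is summable if the flow
  \<open>w x * \<bar>r x\<bar>\<close> is at most a constant times the weight \<open>w (\<sigma> x)\<close> of the target, as injectivity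
  then makes it a part of the series of \<open>w * g\<^sup>2\<close>. This is \<open>integrable_jump_term\<close>.

  The flow bound for breakdowns and repairs is detailed balance (\<open>Y_detailed_balance\<close>). For
  arrivals, departures and moves it follows from the product form: adding a customer at node \<open>j\<close>
  multiplies the weight by \<open>eta j / mu j (n j + 1)\<close>. As service rates are bounded, this factor is
  bounded away from 0 provided that \<open>eta j > 0\<close>; positivity of the solution of the traffic
  equations is derived from irreducibility of the routing matrix (\<open>eta_pos\<close>).
\<close>

section \<open>Integration against weights on a discrete space\<close>

lemma integrable_discrete_measure:
  assumes "\<And>x. 0 \<le> w x"
  shows "integrable (discrete_measure w) h \<longleftrightarrow> integrable (count_space UNIV) (\<lambda>x. w x * h x)"
  unfolding discrete_measure_def point_measure_def
  by (subst integrable_density) (use assms in auto)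

lemma integral_discrete_measure:
  assumes "\<And>x. 0 \<le> w x"
  shows "integral\<^sup>L (discrete_measure w) h = (\<integral>x. w x * h x \<partial>count_space UNIV)"
  unfolding discrete_measure_def point_measure_def
  by (subst integral_density) (use assms in auto)

lemma integrable_count_space_reindex_inj_on:
  fixes h :: "'b \<Rightarrow> real"
  assumes "integrable (count_space UNIV) h" "inj_on \<sigma> S"
  shows "integrable (count_space UNIV) (\<lambda>x. indicator S x * h (\<sigma> x))"
proof -
  have "Infinite_Set_Sum.abs_summable_on h (\<sigma> ` S)"
    using assms(1) abs_summable_on_subset[of h UNIV] by (simp add: abs_summable_on_def)
  then have "Infinite_Set_Sum.abs_summable_on (\<lambda>x. h (\<sigma> x)) S"
    using abs_summable_on_reindex_iff[OF assms(2), of h] by simp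
  then show ?thesis
    by (simp add: abs_summable_on_altdef set_integrable_def)
qed

text \<open>
  The term \<open>f * r * g\<close> is controlled by the bound on the rates; the term with \<open>g (\<sigma> x)\<close> needs the
  flow bound, which replaces \<open>w x\<close> by the weight of the point where \<open>g\<close> is evaluated, so that
  the sum can be reindexed along the injective map \<open>\<sigma>\<close>.
\<close>

lemma integrable_jump_term:
  fixes w r f g :: "'s \<Rightarrow> real"
  assumes nonneg: "\<And>x. 0 \<le> w x"
    and inj: "inj_on \<sigma> {x. r x \<noteq> 0}"
    and bdd: "\<And>x. \<bar>r x\<bar> \<le> K"
    and flow: "\<And>x. w x * \<bar>r x\<bar> \<le> L * w (\<sigma> x)"
    and f: "f \<in> L2_functions (discrete_measure w)"
    and g: "g \<in> L2_functions (discrete_measure w)"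
  shows "integrable (discrete_measure w) (\<lambda>x. f x * (r x * (g (\<sigma> x) - g x)))"
proof -
  let ?S = "{x. r x \<noteq> 0}"
  have sq: "integrable (count_space UNIV) (\<lambda>x. w x * (f x)\<^sup>2)"
    "integrable (count_space UNIV) (\<lambda>x. w x * (g x)\<^sup>2)"
    using f g nonneg by (simp_all add: L2_functions_def integrable_discrete_measure)
  have ag: "\<bar>a * b\<bar> \<le> a\<^sup>2 + b\<^sup>2" for a b :: real
    using sum_squares_bound[of "\<bar>a\<bar>" "\<bar>b\<bar>"] abs_ge_zero[of "a * b"]
    unfolding abs_mult power2_abs by linarith
  have old: "integrable (count_space UNIV) (\<lambda>x. w x * (f x * (r x * g x)))"
  proof (rule Bochner_Integration.integrable_bound)
    show "integrable (count_space UNIV) (\<lambda>x. K * (w x * (f x)\<^sup>2 + w x * (g x)\<^sup>2))"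
      using sq by simp
    have "\<bar>w x * (f x * (r x * g x))\<bar> \<le> K * (w x * (f x)\<^sup>2 + w x * (g x)\<^sup>2)" for x
    proof -
      have "\<bar>w x * (f x * (r x * g x))\<bar> = \<bar>r x\<bar> * (w x * \<bar>f x * g x\<bar>)"
        using nonneg[of x] by (simp add: abs_mult)
      also have "\<dots> \<le> K * (w x * ((f x)\<^sup>2 + (g x)\<^sup>2))"
        using bdd[of x] nonneg[of x] ag[of "f x" "g x"]
        by (intro mult_mono) auto
      finally show ?thesis by (simp add: algebra_simps)
    qed
    then show "AE x in count_space UNIV. norm (w x * (f x * (r x * g x)))
        \<le> norm (K * (w x * (f x)\<^sup>2 + w x * (g x)\<^sup>2))"
      unfolding real_norm_def by (intro AE_I2 order_trans[OF _ abs_ge_self])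
  qed simp
  have new: "integrable (count_space UNIV) (\<lambda>x. w x * (f x * (r x * g (\<sigma> x))))"
  proof (rule Bochner_Integration.integrable_bound)
    show "integrable (count_space UNIV) (\<lambda>x. K * (w x * (f x)\<^sup>2) +
        L * (indicator ?S x * (w (\<sigma> x) * (g (\<sigma> x))\<^sup>2)))"
      using sq(1) integrable_count_space_reindex_inj_on[OF sq(2) inj] by simp
    have "\<bar>w x * (f x * (r x * g (\<sigma> x)))\<bar> \<le> K * (w x * (f x)\<^sup>2) +
        L * (indicator ?S x * (w (\<sigma> x) * (g (\<sigma> x))\<^sup>2))" for x
    proof (cases "r x = 0")
      case True
      then show ?thesis using bdd[of x] nonneg[of x] by simp
    next
      case False
      have "\<bar>w x * (f x * (r x * g (\<sigma> x)))\<bar> = (w x * \<bar>r x\<bar>) * \<bar>f x * g (\<sigma> x)\<bar>"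
        using nonneg[of x] by (simp add: abs_mult)
      also have "\<dots> \<le> (w x * \<bar>r x\<bar>) * ((f x)\<^sup>2 + (g (\<sigma> x))\<^sup>2)"
        using nonneg[of x] ag by (intro mult_left_mono) auto
      also have "\<dots> = \<bar>r x\<bar> * (w x * (f x)\<^sup>2) + (w x * \<bar>r x\<bar>) * (g (\<sigma> x))\<^sup>2"
        by (simp add: algebra_simps)
      also have "\<dots> \<le> K * (w x * (f x)\<^sup>2) + (L * w (\<sigma> x)) * (g (\<sigma> x))\<^sup>2"
        using bdd[of x] flow[of x] nonneg[of x] by (intro add_mono mult_right_mono) auto
      finally show ?thesis using False by simp
    qed
    then show "AE x in count_space UNIV. norm (w x * (f x * (r x * g (\<sigma> x))))
        \<le> norm (K * (w x * (f x)\<^sup>2) + L * (indicator ?S x * (w (\<sigma> x) * (g (\<sigma> x))\<^sup>2)))"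
      unfolding real_norm_def by (intro AE_I2 order_trans[OF _ abs_ge_self])
  qed simp
  have "integrable (count_space UNIV)
      (\<lambda>x. w x * (f x * (r x * g (\<sigma> x))) - w x * (f x * (r x * g x)))"
    using old new by simp
  then show ?thesis
    using nonneg by (simp add: integrable_discrete_measure algebra_simps)
qed

text \<open>
  Fubini's theorem for a product of weights whose first factor is finite, with the second factor
  realised as the law of a random variable.
\<close>

lemma discrete_product_expectation:
  fixes p :: "'a::finite \<Rightarrow> real" and m :: "'b::countable \<Rightarrow> real" and h :: "'a \<times> 'b \<Rightarrow> real"
  assumes p: "\<And>a. 0 \<le> p a" and m: "\<And>b. 0 \<le> m b"
    and X: "distributed P (count_space UNIV) X (\<lambda>b. ennreal (m b))"
    and h: "integrable (discrete_measure (\<lambda>(a, b). p a * m b)) h"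
  shows "integrable P (\<lambda>\<omega>. \<Sum>a\<in>UNIV. p a * h (a, X \<omega>))"
    and "(\<integral>x. h x \<partial>discrete_measure (\<lambda>(a, b). p a * m b)) =
      (\<integral>\<omega>. (\<Sum>a\<in>UNIV. p a * h (a, X \<omega>)) \<partial>P)"
proof -
  let ?w = "\<lambda>(a, b). p a * m b"
  have w: "0 \<le> ?w x" for x
    using p m by (auto split: prod.split)
  have sm: "Infinite_Set_Sum.abs_summable_on (\<lambda>x. ?w x * h x) (UNIV \<times> UNIV)"
    using h w by (simp add: integrable_discrete_measure abs_summable_on_def)
  have fib: "integrable (count_space UNIV) (\<lambda>b. m b * (p a * h (a, b)))" for a
    using abs_summable_on_Sigma_project2[OF sm, of a]
    by (simp add: abs_summable_on_def mult_ac)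
  have intP: "integrable P (\<lambda>\<omega>. p a * h (a, X \<omega>))" for a
    using distributed_integrable[OF X, of "\<lambda>b. p a * h (a, b)"] m fib[of a] by simp
  then show "integrable P (\<lambda>\<omega>. \<Sum>a\<in>UNIV. p a * h (a, X \<omega>))"
    by simp
  have "(\<integral>x. h x \<partial>discrete_measure ?w) = infsetsum (\<lambda>x. ?w x * h x) (UNIV \<times> UNIV)"
    using w by (simp add: integral_discrete_measure infsetsum_def)
  also have "\<dots> = (\<Sum>a\<in>UNIV. infsetsum (\<lambda>b. ?w (a, b) * h (a, b)) UNIV)"
    using infsetsum_Sigma[OF _ _ sm] by simp
  also have "\<dots> = (\<Sum>a\<in>UNIV. \<integral>b. m b * (p a * h (a, b)) \<partial>count_space UNIV)"
    by (simp add: infsetsum_def mult_ac)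
  also have "\<dots> = (\<Sum>a\<in>UNIV. \<integral>\<omega>. p a * h (a, X \<omega>) \<partial>P)"
    using distributed_integral[OF X] m by simp
  also have "\<dots> = (\<integral>\<omega>. (\<Sum>a\<in>UNIV. p a * h (a, X \<omega>)) \<partial>P)"
    using intP by simp
  finally show "(\<integral>x. h x \<partial>discrete_measure ?w) = (\<integral>\<omega>. (\<Sum>a\<in>UNIV. p a * h (a, X \<omega>)) \<partial>P)" .
qed

section \<open>Positivity of the solution of the traffic equations\<close>

lemma stochastic_onD:
  fixes R :: "'i::finite \<Rightarrow> 'i \<Rightarrow> real"
  assumes "stochastic_on S R" "i \<in> S" "j \<in> S"
  shows "0 \<le> R i j" "R i j \<le> 1"
proof -
  have nn: "0 \<le> R i k" if "k \<in> S" for k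
    using assms(1,2) that by (auto simp: stochastic_on_def)
  then show "0 \<le> R i j" using assms(3) by blast
  have "R i j \<le> (\<Sum>k\<in>S. R i k)"
    using nn assms(3) by (intro member_le_sum) auto
  also have "\<dots> = 1" using assms(1,2) by (auto simp: stochastic_on_def)
  finally show "R i j \<le> 1" .
qed

lemma irreducible_matrix_closed_set:
  assumes "irreducible_matrix R" "i \<in> S" "\<And>a b. a \<in> S \<Longrightarrow> 0 < R a b \<Longrightarrow> b \<in> S"
  shows "j \<in> S"
proof -
  have "(i, j) \<in> {(a, b). 0 < R a b}\<^sup>*"
    using assms(1) by (simp add: irreducible_matrix_def)
  then show ?thesis
    by (induction rule: rtrancl_induct) (use assms(2,3) in auto)
qed

lemma (in jackson_network) R_nonneg: "0 \<le> R a b"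
  using stochastic_onD(1)[OF R_stochastic] by simp

text \<open>
  The negative part \<open>v\<close> of \<open>eta\<close> satisfies \<open>v \<le> v R\<close> on the nodes. Summing over the nodes, where
  row \<open>i\<close> of \<open>R\<close> has total mass \<open>1 - R (Some i) None\<close>, forces equality in \<open>v \<le> v R\<close> and
  excludes departures to the sink from nodes with \<open>v i > 0\<close>. So these nodes form a closed set
  without node 0, which contradicts irreducibility unless the set is empty.
\<close>

lemma (in jackson_network) eta_nonneg: "0 \<le> eta j"
proof (rule ccontr)
  assume neg: "\<not> 0 \<le> eta j"
  define v where "v i = max 0 (- eta i)" for i
  have v0: "0 \<le> v i" for i by (simp add: v_def)
  have le: "v k \<le> (\<Sum>i\<in>UNIV. v i * R (Some i) (Some k))" (is "_ \<le> ?s k") for k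
  proof -
    have "- eta k \<le> (\<Sum>i\<in>UNIV. - eta i * R (Some i) (Some k))"
      using traffic[of k] lam_pos R_nonneg[of None "Some k"] by (simp add: sum_negf)
    also have "\<dots> \<le> ?s k"
      by (intro sum_mono mult_right_mono R_nonneg) (simp add: v_def)
    finally have "- eta k \<le> ?s k" .
    moreover have "0 \<le> ?s k" by (intro sum_nonneg mult_nonneg_nonneg v0 R_nonneg)
    ultimately show ?thesis by (simp add: v_def)
  qed
  have row: "(\<Sum>k\<in>UNIV. R (Some i) (Some k)) = 1 - R (Some i) None" for i
  proof -
    have "(\<Sum>b\<in>UNIV. R (Some i) b) = 1"
      using R_stochastic by (simp add: stochastic_on_def)
    then show ?thesis by (simp add: UNIV_option_conv sum.reindex)
  qed
  have tot: "(\<Sum>k\<in>UNIV. ?s k) = (\<Sum>i\<in>UNIV. v i) - (\<Sum>i\<in>UNIV. v i * R (Some i) None)"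
    by (subst sum.swap) (simp add: sum_distrib_left[symmetric] row right_diff_distrib sum_subtractf)
  have vle: "(\<Sum>k\<in>UNIV. v k) \<le> (\<Sum>k\<in>UNIV. ?s k)"
    by (intro sum_mono le)
  have out0: "0 \<le> (\<Sum>i\<in>UNIV. v i * R (Some i) None)"
    by (intro sum_nonneg mult_nonneg_nonneg v0 R_nonneg)
  have "(\<Sum>i\<in>UNIV. v i * R (Some i) None) = 0"
    using tot vle out0 by linarith
  then have out: "v i * R (Some i) None = 0" for i
    by (subst (asm) sum_nonneg_eq_0_iff) (auto intro: mult_nonneg_nonneg v0 R_nonneg)
  have "(\<Sum>k\<in>UNIV. ?s k - v k) = 0"
    using tot vle out0 by (simp add: sum_subtractf)
  then have "?s k - v k = 0" for k
    by (subst (asm) sum_nonneg_eq_0_iff) (use le in auto)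
  then have eq: "v k = ?s k" for k by (metis eq_iff_diff_eq_0)
  let ?S = "{Some i | i. 0 < v i}"
  have "None \<in> ?S"
  proof (rule irreducible_matrix_closed_set[OF R_irreducible])
    show "Some j \<in> ?S" using neg by (simp add: v_def)
    fix a b assume "a \<in> ?S" and ab: "0 < R a b"
    then obtain i where i: "a = Some i" "0 < v i" by blast
    show "b \<in> ?S"
    proof (cases b)
      case None
      then show ?thesis using out[of i] i ab by auto
    next
      case (Some k)
      have "0 < v i * R (Some i) (Some k)" using i ab Some by simp
      also have "\<dots> \<le> ?s k"
        by (rule member_le_sum[of i UNIV "\<lambda>i. v i * R (Some i) (Some k)"])
          (auto intro: mult_nonneg_nonneg v0 R_nonneg)
      finally show ?thesis using eq[of k] Some by simp
    qed
  qed
  then show False by simp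
qed

text \<open>
  Positivity spreads from the source: once \<open>eta \<ge> 0\<close> is known, every node that can be entered from
  the source or from a node with positive throughput has itself positive throughput.
\<close>

lemma (in jackson_network) eta_pos: "0 < eta j"
proof -
  let ?S = "insert None {Some i | i. 0 < eta i}"
  have "Some j \<in> ?S"
  proof (rule irreducible_matrix_closed_set[OF R_irreducible])
    show "None \<in> ?S" by simp
    fix a b assume a: "a \<in> ?S" and ab: "0 < R a b"
    show "b \<in> ?S"
    proof (cases b)
      case (Some k)
      let ?t = "\<lambda>i. eta i * R (Some i) (Some k)"
      have t0: "0 \<le> ?t i" for i by (intro mult_nonneg_nonneg eta_nonneg R_nonneg)
      have l0: "0 \<le> lam * R None (Some k)" using lam_pos R_nonneg by simp
      have "0 < lam * R None (Some k) + (\<Sum>i\<in>UNIV. ?t i)"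
      proof (cases a)
        case None
        then show ?thesis using ab Some lam_pos sum_nonneg[of UNIV ?t] t0
          by (simp add: add_pos_nonneg)
      next
        case (Some i)
        have "0 < ?t i" using a ab Some \<open>b = Some k\<close> by auto
        also have "\<dots> \<le> (\<Sum>i\<in>UNIV. ?t i)"
          by (rule member_le_sum[of i UNIV ?t]) (auto intro: t0)
        finally show ?thesis using l0 by linarith
      qed
      then show ?thesis using traffic[of k] Some by simp
    qed simp
  qed
  then show ?thesis by auto
qed

section \<open>Stationary flow between neighbouring queue length vectors\<close>

lemma (in jackson_network) mu_nonneg: "0 \<le> mu j k"
  using mu_zero[of j] mu_pos[of k j] by (cases k) (auto intro: less_imp_le)

lemma (in jackson_network) network_dist_pos: "0 < network_dist mu eta n"
proof -
  have pp: "0 < (\<Prod>k=1..m. eta j / mu j k)" for j m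
    by (intro prod_pos) (auto intro!: divide_pos_pos eta_pos mu_pos)
  have "0 < (\<Sum>m. \<Prod>k=1..m. eta j / mu j k)" for j
    by (intro suminf_pos network_ergodic pp)
  then show ?thesis
    unfolding network_dist_def by (intro prod_pos ballI mult_pos_pos pp) simp
qed

lemma (in jackson_network) network_dist_arrive:
  "network_dist mu eta (arrive j n) * mu j (n j + 1) = network_dist mu eta n * eta j"
proof -
  let ?F = "\<lambda>n i. inverse (\<Sum>m. \<Prod>k=1..m. eta i / mu i k) * (\<Prod>k=1..n i. eta i / mu i k)"
  have "network_dist mu eta (arrive j n) = ?F (arrive j n) j * (\<Prod>i\<in>UNIV - {j}. ?F (arrive j n) i)"
    unfolding network_dist_def by (rule prod.remove) auto
  also have "(\<Prod>i\<in>UNIV - {j}. ?F (arrive j n) i) = (\<Prod>i\<in>UNIV - {j}. ?F n i)"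
    by (intro prod.cong) (auto simp: arrive_def)
  also have "?F (arrive j n) j = ?F n j * (eta j / mu j (n j + 1))"
    by (simp add: arrive_def)
  also have "?F n j * (eta j / mu j (n j + 1)) * (\<Prod>i\<in>UNIV - {j}. ?F n i) =
      (eta j / mu j (n j + 1)) * (?F n j * (\<Prod>i\<in>UNIV - {j}. ?F n i))"
    by simp
  also have "?F n j * (\<Prod>i\<in>UNIV - {j}. ?F n i) = network_dist mu eta n"
    unfolding network_dist_def by (rule prod.remove[symmetric]) auto
  finally show ?thesis
    using mu_pos[of "n j + 1" j] by simp
qed

text \<open>
  The bound on the service rates enters here: without it, the weight could decrease arbitrarily
  fast along arrivals, and the flow due to arrivals would not be dominated by the target weight.
\<close>

lemma (in jackson_network) arrive_flow:
  assumes "\<And>j k. mu j k \<le> M"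
  shows "network_dist mu eta n \<le> M / eta j * network_dist mu eta (arrive j n)"
proof -
  have "network_dist mu eta n * eta j \<le> network_dist mu eta (arrive j n) * M"
    unfolding network_dist_arrive[symmetric]
    by (intro mult_left_mono assms less_imp_le[OF network_dist_pos])
  then show ?thesis using eta_pos[of j] by (simp add: field_simps)
qed

lemma (in jackson_network) depart_flow:
  "network_dist mu eta n * mu j (n j) \<le> eta j * network_dist mu eta (depart j n)"
proof (cases "n j = 0")
  case True
  then show ?thesis
    using eta_nonneg[of j] less_imp_le[OF network_dist_pos] by (simp add: mu_zero)
next
  case False
  then have "arrive j (depart j n) = n" "depart j n j + 1 = n j"
    by (auto simp: arrive_def depart_def)
  with network_dist_arrive[of j "depart j n"] show ?thesis by (simp add: mult.commute)
qed

lemma inj_arrive: "inj (arrive j)"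
  by (rule injI) (auto simp: arrive_def fun_eq_iff split: if_splits)

lemma inj_on_depart: "inj_on (depart j) {n. n j \<noteq> 0}"
proof (rule inj_on_inverseI)
  show "arrive j (depart j n) = n" if "n \<in> {n. n j \<noteq> 0}" for n
    using that by (auto simp: arrive_def depart_def)
qed

section \<open>Reversibility of the breakdown and repair process\<close>

lemma Y_gen_eq_sum:
  "Y_gen A B h D = (\<Sum>E\<in>UNIV. Y_rate A B D E * (h E - h D))"
proof -
  have "(\<Sum>E\<in>UNIV. Y_rate A B D E * (h E - h D)) =
      (\<Sum>E\<in>{H. H \<subset> D} \<union> {I. D \<subset> I}. Y_rate A B D E * (h E - h D))"
    by (rule sum.mono_neutral_right) (auto simp: Y_rate_def)
  also have "\<dots> = Y_gen A B h D"
    unfolding Y_gen_def by (rule sum.union_disjoint) auto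
  finally show ?thesis by simp
qed

lemma Y_dist_nonneg: "0 \<le> Y_dist A B D"
  by (simp add: Y_dist_def)

lemma (in breakdown_repair) A_eq_0: "D \<subset> I \<Longrightarrow> A D = 0 \<Longrightarrow> A I = 0"
  using A_quotient[of D I] A_nonneg[of I]
  by (auto simp: ennreal_divide_eq_top_iff ennreal_eq_0_iff less_top[symmetric])

lemma (in breakdown_repair) B_eq_0: "D \<subset> I \<Longrightarrow> B D = 0 \<Longrightarrow> B I = 0"
  using B_quotient[of D I] B_nonneg[of I]
  by (auto simp: ennreal_divide_eq_top_iff ennreal_eq_0_iff less_top[symmetric])

text \<open>
  Either some quotient \<open>A I / B I\<close> is infinite, which makes the normalised weights vanish, or all
  quotients are finite and may be computed in the reals.
\<close>

lemma (in breakdown_repair) Y_dist_cases: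
  obtains (degenerate) "\<And>D. Y_dist A B D = 0"
  | (normalised) s where "\<And>D. Y_dist A B D = A D / B D / s" "\<And>D. B D = 0 \<Longrightarrow> A D = 0"
proof (cases "(\<Sum>I\<in>UNIV. ennreal (A I) / ennreal (B I)) = \<top>")
  case True
  have "Y_dist A B D = 0" for D
    by (simp add: Y_dist_def True)
  then show ?thesis by (rule degenerate)
next
  case False
  define S where "S = (\<Sum>I\<in>UNIV. ennreal (A I) / ennreal (B I))"
  have fin: "ennreal (A D) / ennreal (B D) \<noteq> \<top>" for D
    using False by (simp add: ennreal_sum_eq_top)
  have AB: "A D = 0" if "B D = 0" for D
    using fin[of D] A_nonneg[of D] that
    by (auto simp: ennreal_divide_eq_top_iff ennreal_eq_0_iff split: if_splits)
  have q: "ennreal (A D) / ennreal (B D) = ennreal (A D / B D)" for D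
    using AB[of D] A_nonneg[of D] B_nonneg[of D]
    by (cases "B D = 0") (auto simp: divide_ennreal)
  obtain s where s: "0 \<le> s" "S = ennreal s"
    using False by (cases S) (auto simp: S_def)
  have "ennreal (A {}) / ennreal (B {}) \<le> S"
    unfolding S_def by (rule member_le_sum) auto
  then have "0 < s"
    using s by (auto simp: A_empty B_empty order_le_less)
  have "Y_dist A B D = A D / B D / s" for D
  proof -
    have "Y_dist A B D = enn2real (ennreal (A D) / ennreal (B D) / S)"
      by (simp only: Y_dist_def S_def)
    also have "\<dots> = A D / B D / s"
      using A_nonneg[of D] B_nonneg[of D] \<open>0 < s\<close> by (simp add: q s(2) divide_ennreal)
    finally show ?thesis .
  qed
  then show ?thesis by (rule normalised) (use AB in auto)
qed

text \<open>
  For \<open>D \<subset> E\<close> both sides equal \<open>A E / B D\<close> up to normalisation. This cancels \<open>A D\<close> and \<open>B E\<close>,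
  which may be 0; but zeros of \<open>A\<close> and \<open>B\<close> are inherited by larger sets, and zeros of \<open>B\<close> are
  zeros of \<open>A\<close> unless \<open>Y_dist A B\<close> vanishes, so that both sides are 0 in these cases.
\<close>

lemma (in breakdown_repair) Y_detailed_balance:
  "Y_dist A B D * Y_rate A B D E = Y_dist A B E * Y_rate A B E D"
proof -
  have up: "Y_dist A B D * Y_rate A B D E = Y_dist A B E * Y_rate A B E D" if "D \<subset> E" for D E
  proof (cases rule: Y_dist_cases)
    case (normalised s)
    have "Y_rate A B D E = A E / A D" "Y_rate A B E D = B E / B D"
      using that by (auto simp: Y_rate_def)
    then show ?thesis
      using normalised A_eq_0[OF that] B_eq_0[OF that]
      by (cases "A D = 0"; cases "B D = 0"; cases "B E = 0") auto
  qed simp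
  show ?thesis
  proof (cases "D \<subset> E \<or> E \<subset> D")
    case False
    then show ?thesis by (auto simp: Y_rate_def)
  qed (use up[of D E] up[of E D, symmetric] in blast)
qed

section \<open>Integrability of the two parts of the generator\<close>

text \<open>
  The map \<open>(D, n) \<mapsto> (E, n)\<close> forgets \<open>D\<close>, so the jumps are separated by their origin as well as
  by their target in order to be injective.
\<close>

lemma Y_part_integrable:
  fixes m :: "('j::finite \<Rightarrow> nat) \<Rightarrow> real" and f g :: "'j set \<times> ('j \<Rightarrow> nat) \<Rightarrow> real"
  assumes br: "breakdown_repair A B"
    and m: "\<And>n. 0 \<le> m n"
    and w: "w = (\<lambda>(D, n). Y_dist A B D * m n)"
    and f: "f \<in> L2_functions (discrete_measure w)"
    and g: "g \<in> L2_functions (discrete_measure w)"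
  shows "integrable (discrete_measure w) (\<lambda>(D, n). f (D, n) * Y_gen A B (\<lambda>E. g (E, n)) D)"
proof -
  interpret breakdown_repair A B by (rule br)
  have w0: "0 \<le> w x" for x
    using m by (auto simp: w Y_dist_nonneg split: prod.split)
  let ?r = "\<lambda>D E x. if fst x = D then Y_rate A B D E else 0"
  let ?\<sigma> = "\<lambda>E x. (E, snd x)"
  have "integrable (discrete_measure w) (\<lambda>x. f x * (?r D E x * (g (?\<sigma> E x) - g x)))" for D E
  proof (rule integrable_jump_term[OF w0 _ _ _ f g])
    show "inj_on (?\<sigma> E) {x. ?r D E x \<noteq> 0}"
      by (auto simp: inj_on_def split: if_splits)
    show "\<bar>?r D E x\<bar> \<le> \<bar>Y_rate A B D E\<bar>" for x by simp
    show "w x * \<bar>?r D E x\<bar> \<le> \<bar>Y_rate A B E D\<bar> * w (?\<sigma> E x)" for x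
    proof (cases "fst x = D")
      case True
      have balance: "Y_dist A B D * \<bar>Y_rate A B D E\<bar> = Y_dist A B E * \<bar>Y_rate A B E D\<bar>"
        using arg_cong[OF Y_detailed_balance[of D E], of abs] by (simp add: abs_mult Y_dist_nonneg)
      have "w x * \<bar>?r D E x\<bar> = m (snd x) * (Y_dist A B D * \<bar>Y_rate A B D E\<bar>)"
        using True by (simp add: w case_prod_beta)
      also have "\<dots> = m (snd x) * (Y_dist A B E * \<bar>Y_rate A B E D\<bar>)"
        by (simp only: balance)
      also have "\<dots> = \<bar>Y_rate A B E D\<bar> * w (?\<sigma> E x)"
        by (simp add: w)
      finally show ?thesis by simp
    next
      case False
      then show ?thesis using w0[of "?\<sigma> E x"] by simp
    qed
  qed
  then have "integrable (discrete_measure w)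
      (\<lambda>x. \<Sum>D\<in>UNIV. \<Sum>E\<in>UNIV. f x * (?r D E x * (g (?\<sigma> E x) - g x)))"
    by (intro Bochner_Integration.integrable_sum)
  also have "(\<lambda>x. \<Sum>D\<in>UNIV. \<Sum>E\<in>UNIV. f x * (?r D E x * (g (?\<sigma> E x) - g x))) =
      (\<lambda>(D, n). f (D, n) * Y_gen A B (\<lambda>E. g (E, n)) D)"
  proof (rule ext, clarify)
    fix D n
    have "(\<Sum>D'\<in>UNIV. \<Sum>E\<in>UNIV. f (D, n) * (?r D' E (D, n) * (g (E, n) - g (D, n)))) =
      (\<Sum>D'\<in>UNIV. if D = D' then f (D, n) * Y_gen A B (\<lambda>E. g (E, n)) D' else 0)"
      by (intro sum.cong) (auto simp: Y_gen_eq_sum sum_distrib_left)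
    then show "(\<Sum>D'\<in>UNIV. \<Sum>E\<in>UNIV. f (D, n) * (?r D' E (D, n) *
        (g (?\<sigma> E (D, n)) - g (D, n)))) = f (D, n) * Y_gen A B (\<lambda>E. g (E, n)) D"
      by simp
  qed
  finally show ?thesis .
qed

text \<open>The movements of customers, common to all choices of breakdown and repair rates.\<close>

definition X_gen ::
  "real \<Rightarrow> ('j::finite \<Rightarrow> nat \<Rightarrow> real) \<Rightarrow> ('j set \<Rightarrow> 'j option \<Rightarrow> 'j option \<Rightarrow> real) \<Rightarrow>
   ('j set \<times> ('j \<Rightarrow> nat) \<Rightarrow> real) \<Rightarrow> 'j set \<times> ('j \<Rightarrow> nat) \<Rightarrow> real" where
  "X_gen lam mu RD f = (\<lambda>(D, n).
     (\<Sum>j\<in>-D. lam * RD D None (Some j) * (f (D, arrive j n) - f (D, n))) +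
     (\<Sum>j\<in>-D. mu j (n j) * RD D (Some j) None * (f (D, depart j n) - f (D, n))) +
     (\<Sum>j\<in>-D. mu j (n j) *
        (\<Sum>i\<in>-D. RD D (Some j) (Some i) * (f (D, arrive i (depart j n)) - f (D, n)))))"

lemma Z_gen_eq: "Z_gen lam mu RD A B f (D, n) =
    X_gen lam mu RD f (D, n) + Y_gen A B (\<lambda>E. f (E, n)) D"
  by (simp add: Z_gen_def X_gen_def)

lemma inj_on_map_prod_id:
  assumes "inj_on \<phi> S" "T \<subseteq> UNIV \<times> S"
  shows "inj_on (map_prod id \<phi>) T"
  using map_prod_inj_on[OF inj_on_id assms(1)] assms(2) by (rule inj_on_subset)

text \<open>
  A move from \<open>j\<close> to \<open>i\<close> is a departure followed by an arrival, so its flow bound is the product of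
  the bounds for these two steps. The laws of the queue lengths and of the set of broken down nodes
  are independent and \<open>X_gen\<close> does not change the latter, so any nonnegative weights \<open>p\<close> may be used there.
\<close>

lemma (in rerouted_jackson_network) X_part_integrable:
  fixes f g :: "'j set \<times> ('j \<Rightarrow> nat) \<Rightarrow> real"
  assumes p: "\<And>D. 0 \<le> p D"
    and w: "w = (\<lambda>(D, n). p D * network_dist mu eta n)"
    and f: "f \<in> L2_functions (discrete_measure w)"
    and g: "g \<in> L2_functions (discrete_measure w)"
  shows "integrable (discrete_measure w) (\<lambda>x. f x * X_gen lam mu RD g x)"
proof -
  obtain M where M: "mu j k \<le> M" for j k
    using mu_bounded by (force simp: bdd_above_def)
  have M0: "0 \<le> M" using M mu_nonneg order_trans by blast
  let ?m = "network_dist mu eta"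
  have m0: "0 \<le> ?m n" for n using network_dist_pos less_imp_le by blast
  have w0: "0 \<le> w x" for x
    using p m0 by (auto simp: w split: prod.split)
  have RD01: "0 \<le> RD D a b \<and> RD D a b \<le> 1"
    if "set_option a \<inter> D = {}" "set_option b \<inter> D = {}" for D a b
    using stochastic_onD[OF RD_stochastic[of D], of a b] that by (auto simp: image_iff)

  \<comment> \<open>Rates \<open>ra\<close>, \<open>rd\<close>, \<open>rm\<close> and jump maps \<open>sa\<close>, \<open>sd\<close>, \<open>sm\<close> of arrivals, departures and moves. A rate
    vanishes at broken down nodes, so that the sums over \<open>-D\<close> become sums over all nodes.\<close>
  define ra where "ra j = (\<lambda>(D, n :: 'j \<Rightarrow> nat). if j \<in> D then 0 else lam * RD D None (Some j))" for j
  define rd where "rd j = (\<lambda>(D, n). if j \<in> D then 0 else mu j (n j) * RD D (Some j) None)" for j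
  define rm where "rm j i = (\<lambda>(D, n). if j \<in> D \<or> i \<in> D then 0
      else mu j (n j) * RD D (Some j) (Some i))" for j i
  define sa where "sa j = map_prod (id :: 'j set \<Rightarrow> 'j set) (arrive j)" for j :: 'j
  define sd where "sd j = map_prod (id :: 'j set \<Rightarrow> 'j set) (depart j)" for j :: 'j
  define sm where "sm j i = map_prod (id :: 'j set \<Rightarrow> 'j set) (arrive i \<circ> depart j)" for j i :: 'j

  have arr: "integrable (discrete_measure w) (\<lambda>x. f x * (ra j x * (g (sa j x) - g x)))" for j
  proof (rule integrable_jump_term[OF w0 _ _ _ f g])
    show "inj_on (sa j) {x. ra j x \<noteq> 0}"
      unfolding sa_def
      by (rule inj_on_map_prod_id[OF inj_arrive]) auto
    have ra: "0 \<le> ra j x" "ra j x \<le> lam" for x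
      using RD01[of None "fst x" "Some j"] lam_pos
      by (auto simp: ra_def mult_left_le split: prod.split)
    then show "\<bar>ra j x\<bar> \<le> lam" for x by simp
    show "w x * \<bar>ra j x\<bar> \<le> lam * (M / eta j) * w (sa j x)" for x
    proof -
      obtain D n where x: "x = (D, n)" by (cases x)
      have "w x * \<bar>ra j x\<bar> \<le> w x * lam"
        using w0 ra by (intro mult_left_mono) auto
      also have "\<dots> = lam * (p D * ?m n)" by (simp add: w x)
      also have "\<dots> \<le> lam * (p D * (M / eta j * ?m (arrive j n)))"
        by (intro mult_left_mono arrive_flow M p less_imp_le[OF lam_pos])
      finally show ?thesis by (simp add: w x sa_def mult_ac)
    qed
  qed
  have dep: "integrable (discrete_measure w) (\<lambda>x. f x * (rd j x * (g (sd j x) - g x)))" for j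
  proof (rule integrable_jump_term[OF w0 _ _ _ f g])
    show "inj_on (sd j) {x. rd j x \<noteq> 0}"
      unfolding sd_def
      by (rule inj_on_map_prod_id[OF inj_on_depart])
        (auto simp: rd_def mu_zero split: if_splits intro!: gr0I)
    have rd: "0 \<le> rd j x" "rd j x \<le> mu j (snd x j)" for x
      using RD01[of "Some j" "fst x" None] mu_nonneg
      by (auto simp: rd_def mult_left_le split: prod.split)
    show "\<bar>rd j x\<bar> \<le> M" for x using rd[of x] M[of j "snd x j"] by linarith
    show "w x * \<bar>rd j x\<bar> \<le> eta j * w (sd j x)" for x
    proof -
      obtain D n where x: "x = (D, n)" by (cases x)
      have "w x * \<bar>rd j x\<bar> \<le> w x * mu j (n j)"
        using w0 rd[of x] x by (intro mult_left_mono) auto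
      also have "\<dots> = p D * (?m n * mu j (n j))" by (simp add: w x)
      also have "\<dots> \<le> p D * (eta j * ?m (depart j n))"
        by (intro mult_left_mono depart_flow p)
      finally show ?thesis by (simp add: w x sd_def mult_ac)
    qed
  qed
  have mov: "integrable (discrete_measure w) (\<lambda>x. f x * (rm j i x * (g (sm j i x) - g x)))" for j i
  proof (rule integrable_jump_term[OF w0 _ _ _ f g])
    show "inj_on (sm j i) {x. rm j i x \<noteq> 0}"
      unfolding sm_def
      by (rule inj_on_map_prod_id[OF comp_inj_on[OF inj_on_depart
              inj_on_subset[OF inj_arrive subset_UNIV]]])
        (auto simp: rm_def mu_zero split: if_splits intro!: gr0I)
    have rm: "0 \<le> rm j i x" "rm j i x \<le> mu j (snd x j)" for x
      using RD01[of "Some j" "fst x" "Some i"] mu_nonneg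
      by (auto simp: rm_def mult_left_le split: prod.split)
    show "\<bar>rm j i x\<bar> \<le> M" for x using rm[of x] M[of j "snd x j"] by linarith
    show "w x * \<bar>rm j i x\<bar> \<le> eta j * (M / eta i) * w (sm j i x)" for x
    proof -
      obtain D n where x: "x = (D, n)" by (cases x)
      have "w x * \<bar>rm j i x\<bar> \<le> w x * mu j (n j)"
        using w0 rm[of x] x by (intro mult_left_mono) auto
      also have "\<dots> = p D * (?m n * mu j (n j))" by (simp add: w x)
      also have "\<dots> \<le> p D * (eta j * ?m (depart j n))"
        by (intro mult_left_mono depart_flow p)
      also have "\<dots> \<le> p D * (eta j * (M / eta i * ?m (arrive i (depart j n))))"
        by (intro mult_left_mono arrive_flow M p eta_nonneg)
      finally show ?thesis by (simp add: w x sm_def mult_ac)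
    qed
  qed
  have "f x * X_gen lam mu RD g x =
      (\<Sum>j\<in>UNIV. f x * (ra j x * (g (sa j x) - g x))) +
      (\<Sum>j\<in>UNIV. f x * (rd j x * (g (sd j x) - g x))) +
      (\<Sum>j\<in>UNIV. \<Sum>i\<in>UNIV. f x * (rm j i x * (g (sm j i x) - g x)))" for x
  proof -
    obtain D n where x: "x = (D, n)" by (cases x)
    have restrict: "(\<Sum>j\<in>-D. u j) = (\<Sum>j\<in>UNIV. if j \<in> D then 0 else u j)" for u :: "'j \<Rightarrow> real"
      by (rule sum.mono_neutral_cong_left) auto
    have "(\<Sum>j\<in>UNIV. ra j x * (g (sa j x) - g x)) =
        (\<Sum>j\<in>-D. lam * RD D None (Some j) * (g (D, arrive j n) - g (D, n)))"
      unfolding restrict by (intro sum.cong) (auto simp: x ra_def sa_def)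
    moreover have "(\<Sum>j\<in>UNIV. rd j x * (g (sd j x) - g x)) =
        (\<Sum>j\<in>-D. mu j (n j) * RD D (Some j) None * (g (D, depart j n) - g (D, n)))"
      unfolding restrict by (intro sum.cong) (auto simp: x rd_def sd_def)
    moreover have "(\<Sum>j\<in>UNIV. \<Sum>i\<in>UNIV. rm j i x * (g (sm j i x) - g x)) =
        (\<Sum>j\<in>-D. mu j (n j) *
          (\<Sum>i\<in>-D. RD D (Some j) (Some i) * (g (D, arrive i (depart j n)) - g (D, n))))"
      unfolding restrict sum_distrib_left
      by (intro sum.cong) (auto simp: x rm_def sm_def sum_distrib_left intro!: sum.cong)
    ultimately show ?thesis
      by (simp only: x X_gen_def prod.case distrib_left sum_distrib_left[symmetric])
  qed
  then show ?thesis using arr dep mov by simp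
qed

theorem theorem3p4:
  fixes lam :: real
    and R :: "'j::finite option \<Rightarrow> 'j option \<Rightarrow> real"
    and mu :: "'j \<Rightarrow> nat \<Rightarrow> real"
    and eta :: "'j \<Rightarrow> real"
    and RD :: "'j set \<Rightarrow> 'j option \<Rightarrow> 'j option \<Rightarrow> real"
    and A B A' B' :: "'j set \<Rightarrow> real"
    and f g :: "'j set \<times> ('j \<Rightarrow> nat) \<Rightarrow> real"
    and P :: "'w measure"
    and Xt :: "'w \<Rightarrow> 'j \<Rightarrow> nat"
  defines "QZ \<equiv> Z_gen lam mu RD A B"
    and "QZ' \<equiv> Z_gen lam mu RD A' B'"
    and "QY \<equiv> Y_gen A B"
    and "QY' \<equiv> Y_gen A' B'"
    and "pihat \<equiv> Y_dist A B"
    and "pitilde \<equiv> discrete_measure (Z_dist mu eta A B)"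
  assumes "rerouted_jackson_network lam R mu eta RD"
    and "breakdown_repair A B"
    and "breakdown_repair A' B'"
    and "ergodic_process QZ"
    and "\<forall>D. Y_dist A B D = Y_dist A' B' D"
    and "f \<in> L2_functions pitilde"
    and "g \<in> L2_functions pitilde"
    and "prob_space P"
    and "distributed P (count_space UNIV) Xt (\<lambda>n. ennreal (network_dist mu eta n))"
  shows "integrable pitilde (\<lambda>x. f x * QZ g x) \<and>
    integrable pitilde (\<lambda>x. f x * QZ' g x) \<and>
    integrable P (\<lambda>\<omega>.
      Y_inner pihat (\<lambda>D. f (D, Xt \<omega>)) ((QY - QY') (\<lambda>D. g (D, Xt \<omega>)))) \<and>
    inner_on pitilde f (QZ g) - inner_on pitilde f (QZ' g) =
      (\<integral>\<omega>. Y_inner pihat (\<lambda>D. f (D, Xt \<omega>)) (QY (\<lambda>D. g (D, Xt \<omega>))) -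
           Y_inner pihat (\<lambda>D. f (D, Xt \<omega>)) (QY' (\<lambda>D. g (D, Xt \<omega>))) \<partial>P) \<and>
    (\<integral>\<omega>. Y_inner pihat (\<lambda>D. f (D, Xt \<omega>)) (QY (\<lambda>D. g (D, Xt \<omega>))) -
         Y_inner pihat (\<lambda>D. f (D, Xt \<omega>)) (QY' (\<lambda>D. g (D, Xt \<omega>))) \<partial>P) =
      (\<integral>\<omega>. Y_inner pihat (\<lambda>D. f (D, Xt \<omega>)) ((QY - QY') (\<lambda>D. g (D, Xt \<omega>))) \<partial>P)"
proof -
  interpret rerouted_jackson_network lam R mu eta RD by fact
  let ?m = "network_dist mu eta"
  have m0: "0 \<le> ?m n" for n using network_dist_pos less_imp_le by blast
  have same: "Y_dist A B = Y_dist A' B'" using \<open>\<forall>D. Y_dist A B D = Y_dist A' B' D\<close> by auto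
  define w where "w = (\<lambda>(D, n). Y_dist A B D * ?m n)"
  have pit: "pitilde = discrete_measure w"
    by (simp add: pitilde_def Z_dist_def w_def)
  have w': "w = (\<lambda>(D, n). Y_dist A' B' D * ?m n)" by (simp add: w_def same)
  have f: "f \<in> L2_functions (discrete_measure w)" and g: "g \<in> L2_functions (discrete_measure w)"
    using assms by (simp_all add: pit)
  have iX: "integrable pitilde (\<lambda>x. f x * X_gen lam mu RD g x)"
    unfolding pit by (rule X_part_integrable[OF Y_dist_nonneg w_def f g])
  have iY: "integrable pitilde (\<lambda>(D, n). f (D, n) * QY (\<lambda>E. g (E, n)) D)"
    unfolding pit QY_def by (rule Y_part_integrable[OF \<open>breakdown_repair A B\<close> m0 w_def f g])
  have iY': "integrable pitilde (\<lambda>(D, n). f (D, n) * QY' (\<lambda>E. g (E, n)) D)"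
    unfolding pit QY'_def by (rule Y_part_integrable[OF \<open>breakdown_repair A' B'\<close> m0 w' f g])
  have QZ: "(\<lambda>x. f x * QZ g x) =
      (\<lambda>x. f x * X_gen lam mu RD g x + (case x of (D, n) \<Rightarrow> f (D, n) * QY (\<lambda>E. g (E, n)) D))"
    by (auto simp: QZ_def QY_def Z_gen_eq distrib_left)
  have QZ': "(\<lambda>x. f x * QZ' g x) =
      (\<lambda>x. f x * X_gen lam mu RD g x + (case x of (D, n) \<Rightarrow> f (D, n) * QY' (\<lambda>E. g (E, n)) D))"
    by (auto simp: QZ'_def QY'_def Z_gen_eq distrib_left)
  have iZ: "integrable pitilde (\<lambda>x. f x * QZ g x)"
    unfolding QZ using iX iY by (rule Bochner_Integration.integrable_add)
  have iZ': "integrable pitilde (\<lambda>x. f x * QZ' g x)"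
    unfolding QZ' using iX iY' by (rule Bochner_Integration.integrable_add)
  let ?h = "\<lambda>(D, n). f (D, n) * (QY - QY') (\<lambda>E. g (E, n)) D"
  have h: "(\<lambda>x. f x * QZ g x - f x * QZ' g x) = ?h"
  proof
    show "f x * QZ g x - f x * QZ' g x = ?h x" for x
      using fun_cong[OF QZ, of x] fun_cong[OF QZ', of x] by (cases x) (simp add: right_diff_distrib)
  qed
  have ih: "integrable pitilde ?h"
    unfolding h[symmetric] using iZ iZ' by (rule Bochner_Integration.integrable_diff)
  have inner: "Y_inner pihat (\<lambda>D. f (D, n)) ((QY - QY') (\<lambda>D. g (D, n))) =
      (\<Sum>D\<in>UNIV. Y_dist A B D * ?h (D, n))" for n
    by (simp add: Y_inner_def pihat_def mult.assoc)
  have split: "Y_inner pihat (\<lambda>D. f (D, n)) (QY (\<lambda>D. g (D, n))) -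
      Y_inner pihat (\<lambda>D. f (D, n)) (QY' (\<lambda>D. g (D, n))) =
      Y_inner pihat (\<lambda>D. f (D, n)) ((QY - QY') (\<lambda>D. g (D, n)))" for n
    by (simp add: Y_inner_def right_diff_distrib sum_subtractf)
  note X = \<open>distributed P (count_space UNIV) Xt (\<lambda>n. ennreal (?m n))\<close>
  note ex = discrete_product_expectation[OF Y_dist_nonneg m0 X ih[unfolded pit w_def]]
  have "inner_on pitilde f (QZ g) - inner_on pitilde f (QZ' g) = (\<integral>x. ?h x \<partial>pitilde)"
    unfolding inner_on_def h[symmetric]
    by (rule Bochner_Integration.integral_diff[symmetric]) (use iZ iZ' in auto)
  then show ?thesis
    using iZ iZ' ex unfolding split inner pit w_def by simp
qed

end
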